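(* On the semigroup $\mathscr{C}_{\mathbb{Z}}^{\mathbf{0}}$ (the extended bicyclic semigroup with adjoined zero) there exist $\mathfrak{c}$ many (pairwise different) Hausdorff locally compact shift-continuous topologies, where $\mathfrak{c}$ is the cardinality of the continuum.
   Context: The extended bicyclic semigroup is the set $\mathscr{C}_{\mathbb{Z}}=\mathbb{Z}\times\mathbb{Z}$ with the operation $(a,b)\cdot(c,d)=(a-b+c,d)$ if $b<c$; $(a,b)\cdot(c,d)=(a,d)$ if $b=c$; $(a,b)\cdot(c,d)=(a,d+b-c)$ if $b>c$. $\mathscr{C}_{\mathbb{Z}}^{\mathbf{0}}=\mathscr{C}_{\mathbb{Z}}\sqcup\{\mathbf{0}\}$ is $\mathscr{C}_{\mathbb{Z}}$ with an adjoined zero $\mathbf{0}$ (so $\mathbf{0}\cdot s=s\cdot\mathbf{0}=\mathbf{0}$ for all $s$). A topology $\tau$ on a semigroup $S$ is shift-continuous if $(S,\tau)$ is a semitopological semigroup, i.e. the multiplication is separately continuous (all left shifts $s\mapsto ts$ and right shifts $s\mapsto st$ are continuous). *)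

theory Defs
  imports "HOL-Analysis.Analysis" "HOL-Library.Equipollence"
begin

definition ext_bicyclic_mult :: "int \<times> int \<Rightarrow> int \<times> int \<Rightarrow> int \<times> int" where
  "ext_bicyclic_mult x y =
     (case x of (a, b) \<Rightarrow> case y of (c, d) \<Rightarrow>
        if b < c then (a - b + c, d)
        else if b = c then (a, d)
        else (a, d + b - c))"

text \<open>The zero is adjoined as \<^term>\<open>None\<close>.\<close>

fun adjoin_zero :: "('a \<Rightarrow> 'a \<Rightarrow> 'a) \<Rightarrow> 'a option \<Rightarrow> 'a option \<Rightarrow> 'a option" where
  "adjoin_zero m (Some x) (Some y) = Some (m x y)"
| "adjoin_zero m None y = None"
| "adjoin_zero m (Some x) None = None"

abbreviation ext_bicyclic0_mult ::
    "(int \<times> int) option \<Rightarrow> (int \<times> int) option \<Rightarrow> (int \<times> int) option" where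
  "ext_bicyclic0_mult \<equiv> adjoin_zero ext_bicyclic_mult"

lemma semigroup_ext_bicyclic: "semigroup ext_bicyclic_mult"
  by unfold_locales (auto simp: ext_bicyclic_mult_def split: prod.splits)

lemma semigroup_adjoin_zero:
  assumes "semigroup m"
  shows "semigroup (adjoin_zero m)"
proof
  fix a b c
  show "adjoin_zero m (adjoin_zero m a b) c = adjoin_zero m a (adjoin_zero m b c)"
    by (cases a; cases b; cases c) (simp_all add: semigroup.assoc[OF assms])
qed

definition shift_continuous :: "('a \<Rightarrow> 'a \<Rightarrow> 'a) \<Rightarrow> 'a topology \<Rightarrow> bool" where
  "shift_continuous m T \<longleftrightarrow>
     (\<forall>t. continuous_map T T (\<lambda>s. m t s) \<and> continuous_map T T (\<lambda>s. m s t))"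

end

(* Upper bound: in a countable locally compact Hausdorff space, choose disjoint open neighbourhoods
   for each pair of distinct points and a relatively compact open neighbourhood of each point.
   These countably many sets form a subbase, because covering a compact set by finitely many of
   them separates it from a point.  So a topology is determined by a function from a countable set
   to subsets of a countable set.

   Lower bound: make all nonzero elements isolated and let the neighbourhoods of zero be the sets
   that contain almost all of the complement of a set W.  A left shift by (a, b) maps into the half
   plane of first coordinate at least a, and its fibres are contained in the lower half of a
   diagonal, up to one point.  So shifts are continuous as soon as W meets each half plane
   {c > a} and {d > a} in a finite set and contains almost all of the lower half of each diagonal.
   The cones of different widths around the diagonal of the third quadrant are such sets, no two of
   which agree up to finitely many points. *)
theory Submission
  imports Defs
begin

section \<open>Locally compact Hausdorff topologies on a countable set\<close>

lemma locally_compact_Hausdorff_generated: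
  fixes T :: "'a topology"
  assumes top: "topspace T = UNIV" and H: "Hausdorff_space T" and lc: "locally_compact_space T"
  obtains f :: "'a \<times> 'a \<Rightarrow> 'a set" where "T = topology_generated_by (range f)"
proof -
  have "\<exists>U V. openin T U \<and> openin T V \<and> x \<in> U \<and> y \<in> V \<and> disjnt U V" if "x \<noteq> y" for x y
    using H that top unfolding Hausdorff_space_def by auto
  then obtain A B where AB: "\<And>x y. x \<noteq> y \<Longrightarrow> openin T (A x y) \<and> openin T (B x y) \<and>
      x \<in> A x y \<and> y \<in> B x y \<and> disjnt (A x y) (B x y)"
    by metis
  have "\<exists>U K. openin T U \<and> compactin T K \<and> x \<in> U \<and> U \<subseteq> K" for x
    using lc top unfolding locally_compact_space_def by auto
  then obtain U K where UK: "\<And>x. openin T (U x) \<and> compactin T (K x) \<and> x \<in> U x \<and> U x \<subseteq> K x"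
    by metis
  \<comment> \<open>Off the diagonal only the neighbourhood of the first point is recorded; the
    diagonal entries are free and carry the relatively compact neighbourhoods. The sets
    \<open>B x y\<close> serve to cover compact sets.\<close>
  define f where "f = (\<lambda>(x, y). if x = y then U x else A x y)"
  let ?G = "topology_generated_by (range f)"
  have fT: "openin T (f p)" for p
    by (cases p) (use AB UK in \<open>auto simp: f_def\<close>)
  have fG: "openin ?G (f p)" for p
    by (rule topology_generated_by_Basis) auto
  have "openin T S" if "openin ?G S" for S
  proof -
    have "generate_topology_on (range f) S"
      using that by (simp add: openin_topology_generated_by_iff)
    then show ?thesis
      by (induction rule: generate_topology_on.induct) (use fT in auto)
  qed
  moreover have "openin ?G S" if S: "openin T S" for S
  proof (subst openin_subopen, intro ballI)
    fix x assume x: "x \<in> S"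
    have "compactin T (K x - S)"
      using closed_Int_compactin[of T "topspace T - S" "K x"] S UK top
      by (simp add: Diff_eq Int_commute openin_closedin_eq)
    moreover have B: "openin T (B x y) \<and> y \<in> B x y" if "y \<in> K x - S" for y
    proof -
      have "x \<noteq> y" using that x by auto
      then show ?thesis using AB by blast
    qed
    then have "K x - S \<subseteq> \<Union> (B x ` (K x - S))" by blast
    moreover have "openin T V" if "V \<in> B x ` (K x - S)" for V
      using B that by blast
    ultimately obtain F where F: "finite F" "F \<subseteq> B x ` (K x - S)" "K x - S \<subseteq> \<Union> F"
      using compactinD[of T "K x - S" "B x ` (K x - S)"] by metis
    obtain Y where Y: "finite Y" "Y \<subseteq> K x - S" "F = B x ` Y"
      using finite_subset_image[OF F(1,2)] by blast
    \<comment> \<open>The member \<open>f (x, x)\<close> keeps \<open>V\<close> inside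
      \<open>K x\<close>, and the other members keep it off the sets \<open>B x y\<close> that cover
      \<open>K x - S\<close>.\<close>
    define V where "V = \<Inter> (insert (f (x, x)) ((\<lambda>y. f (x, y)) ` Y))"
    have "openin ?G V"
      unfolding V_def using Y fG by (intro openin_Inter) auto
    moreover have "x \<in> V"
      using Y AB x UK by (auto simp: V_def f_def)
    moreover have "V \<subseteq> S"
    proof
      fix z assume z: "z \<in> V"
      show "z \<in> S"
      proof (rule ccontr)
        assume "z \<notin> S"
        moreover have "z \<in> K x"
          using z UK by (auto simp: V_def f_def)
        ultimately obtain y where y: "y \<in> Y" "z \<in> B x y"
          using F Y by blast
        then have "x \<noteq> y" using Y x by auto
        then have "z \<in> A x y"
          using z y by (auto simp: V_def f_def)
        then show False
          using AB[OF \<open>x \<noteq> y\<close>] y by (auto simp: disjnt_def)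
      qed
    qed
    ultimately show "\<exists>V. openin ?G V \<and> x \<in> V \<and> V \<subseteq> S" by blast
  qed
  ultimately have "T = ?G"
    by (auto simp: topology_eq)
  then show ?thesis by (rule that)
qed

text \<open>A set-valued function is determined by its graph, a subset of a countable product, and
  so by a set of naturals.\<close>

lemma countable_set_valued_lepoll_reals:
  "(UNIV :: ('b::countable \<Rightarrow> 'a::countable set) set) \<lesssim> (UNIV :: real set)"
proof -
  have "inj (\<lambda>f :: 'b \<Rightarrow> 'a set. to_nat ` {(p, x). x \<in> f p})"
  proof (rule injI)
    fix f g :: "'b \<Rightarrow> 'a set"
    assume "to_nat ` {(p, x). x \<in> f p} = to_nat ` {(p, x). x \<in> g p}"
    then have "{(p, x). x \<in> f p} = {(p, x). x \<in> g p}"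
      by (simp add: inj_image_eq_iff)
    then show "f = g"
      by (auto simp: fun_eq_iff set_eq_iff)
  qed
  then have "(UNIV :: ('b \<Rightarrow> 'a set) set) \<lesssim> (UNIV :: nat set set)"
    unfolding lepoll_def by blast
  then show ?thesis
    using nat_sets_eqpoll_reals lepoll_trans2 by blast
qed

lemma locally_compact_Hausdorff_topologies_lepoll_reals:
  "{T :: 'a::countable topology.
      topspace T = UNIV \<and> Hausdorff_space T \<and> locally_compact_space T} \<lesssim> (UNIV :: real set)"
    (is "?L \<lesssim> _")
proof -
  have "?L \<subseteq> (\<lambda>f :: 'a \<times> 'a \<Rightarrow> 'a set. topology_generated_by (range f)) ` UNIV"
    by (metis (mono_tags, lifting) locally_compact_Hausdorff_generated mem_Collect_eq rangeI subsetI)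
  then have "?L \<lesssim> (UNIV :: ('a \<times> 'a \<Rightarrow> 'a set) set)"
    using image_lepoll lepoll_trans subset_imp_lepoll by blast
  then show ?thesis
    using countable_set_valued_lepoll_reals lepoll_trans by blast
qed

section \<open>Topologies with a single non-isolated point\<close>

text \<open>This is the topological sum of the one-point compactification of the discrete set
  \<open>K\<close>, with \<open>None\<close> at infinity, and the discrete complement of
  \<open>K\<close>.\<close>

definition cofinite_at_None :: "'a set \<Rightarrow> 'a option topology" where
  "cofinite_at_None K = topology (\<lambda>U. None \<in> U \<longrightarrow> finite {p \<in> K. Some p \<notin> U})"

lemma openin_cofinite_at_None:
  "openin (cofinite_at_None K) U \<longleftrightarrow> (None \<in> U \<longrightarrow> finite {p \<in> K. Some p \<notin> U})"
proof -
  have "istopology (\<lambda>U. None \<in> U \<longrightarrow> finite {p \<in> K. Some p \<notin> U})"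
    unfolding istopology_def
  proof (intro conjI allI impI)
    fix S T assume "None \<in> S \<longrightarrow> finite {p \<in> K. Some p \<notin> S}"
      "None \<in> T \<longrightarrow> finite {p \<in> K. Some p \<notin> T}" "None \<in> S \<inter> T"
    then have "finite ({p \<in> K. Some p \<notin> S} \<union> {p \<in> K. Some p \<notin> T})" by auto
    then show "finite {p \<in> K. Some p \<notin> S \<inter> T}"
      by (rule rev_finite_subset) auto
  next
    fix \<U> assume *: "\<forall>U\<in>\<U>. None \<in> U \<longrightarrow> finite {p \<in> K. Some p \<notin> U}" "None \<in> \<Union>\<U>"
    then obtain U where "U \<in> \<U>" "finite {p \<in> K. Some p \<notin> U}" by blast
    then show "finite {p \<in> K. Some p \<notin> \<Union>\<U>}"
      by (elim rev_finite_subset) auto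
  qed
  then show ?thesis
    by (simp add: cofinite_at_None_def topology_inverse')
qed

lemma topspace_cofinite_at_None [simp]: "topspace (cofinite_at_None K) = UNIV"
  by (metis (mono_tags, lifting) UNIV_I UNIV_eq_I empty_Collect_eq finite.emptyI
      openin_cofinite_at_None openin_subset subsetD)

text \<open>Each singleton \<open>{Some p}\<close> is clopen, and one of two distinct points has
  this form.\<close>

lemma Hausdorff_cofinite_at_None: "Hausdorff_space (cofinite_at_None K)"
proof -
  let ?T = "cofinite_at_None K"
  have S: "openin ?T {Some p}" "openin ?T (- {Some p})" for p
  proof -
    have "finite {q \<in> K. Some q \<notin> - {Some p}}"
      by (rule finite_subset[of _ "{p}"]) auto
    then show "openin ?T {Some p}" "openin ?T (- {Some p})"
      by (auto simp: openin_cofinite_at_None)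
  qed
  show ?thesis
    unfolding Hausdorff_space_def
  proof (intro allI impI, elim conjE)
    fix x y :: "'a option" assume "x \<noteq> y"
    then consider p where "x = Some p" | p where "y = Some p"
      by (cases x; cases y) auto
    then show "\<exists>U V. openin ?T U \<and> openin ?T V \<and> x \<in> U \<and> y \<in> V \<and> disjnt U V"
    proof cases
      case 1
      show ?thesis
        by (rule exI[of _ "{x}"], rule exI[of _ "- {x}"]) (use 1 S \<open>x \<noteq> y\<close> in \<open>auto simp: disjnt_def\<close>)
    next
      case 2
      show ?thesis
        by (rule exI[of _ "- {y}"], rule exI[of _ "{y}"]) (use 2 S \<open>x \<noteq> y\<close> in \<open>auto simp: disjnt_def\<close>)
    qed
  qed
qed

text \<open>The set \<open>?C\<close> is a compact open neighbourhood of \<open>None\<close>: a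
  member of a cover that contains \<open>None\<close> leaves only finitely many points of it to
  cover. All other points are isolated.\<close>

lemma locally_compact_cofinite_at_None: "locally_compact_space (cofinite_at_None K)"
proof -
  let ?T = "cofinite_at_None K" and ?C = "insert None (Some ` K)"
  have "compactin ?T ?C"
    unfolding compactin_def
  proof (intro conjI allI impI)
    fix \<U> assume "Ball \<U> (openin ?T) \<and> ?C \<subseteq> \<Union>\<U>"
    then have \<U>: "Ball \<U> (openin ?T)" "?C \<subseteq> \<Union>\<U>" by auto
    then obtain U where U: "U \<in> \<U>" "None \<in> U" by auto
    then have "finite {p \<in> K. Some p \<notin> U}"
      using \<U> by (auto simp: openin_cofinite_at_None)
    moreover have "\<forall>p\<in>K. \<exists>V. V \<in> \<U> \<and> Some p \<in> V"
      using \<U>(2) by blast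
    then obtain V where V: "\<And>p. p \<in> K \<Longrightarrow> V p \<in> \<U> \<and> Some p \<in> V p"
      by metis
    ultimately show "\<exists>\<F>. finite \<F> \<and> \<F> \<subseteq> \<U> \<and> ?C \<subseteq> \<Union>\<F>"
      using U by (intro exI[of _ "insert U (V ` {p \<in> K. Some p \<notin> U})"]) auto
  qed simp
  moreover have "{p \<in> K. Some p \<notin> ?C} = {}" by auto
  then have "openin ?T ?C"
    by (simp only: openin_cofinite_at_None finite.emptyI simp_thms)
  ultimately have "\<exists>U C. openin ?T U \<and> compactin ?T C \<and> None \<in> U \<and> U \<subseteq> C" by blast
  moreover have "\<exists>U C. openin ?T U \<and> compactin ?T C \<and> Some p \<in> U \<and> U \<subseteq> C" for p
    by (rule exI[of _ "{Some p}"])+ (auto simp: openin_cofinite_at_None)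
  ultimately show ?thesis
    unfolding locally_compact_space_def by (metis option.exhaust)
qed

text \<open>Continuity is in question only at \<open>None\<close>. A point of \<open>K\<close> can
  miss the preimage of a neighbourhood of \<open>None\<close> only if \<open>g\<close> moves it out
  of \<open>K\<close> or onto one of the finitely many points of \<open>K\<close> outside that
  neighbourhood.\<close>

lemma continuous_map_cofinite_at_None:
  assumes f: "f None = None" "\<And>p. f (Some p) = Some (g p)"
    and fibre: "\<And>q. finite {p \<in> K. g p = q}" and almost: "finite {p \<in> K. g p \<notin> K}"
  shows "continuous_map (cofinite_at_None K) (cofinite_at_None K) f"
proof -
  have "finite {p \<in> K. Some (g p) \<notin> U}" if "finite {q \<in> K. Some q \<notin> U}" for U
  proof (rule finite_subset)
    show "{p \<in> K. Some (g p) \<notin> U} \<subseteq>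
        {p \<in> K. g p \<notin> K} \<union> (\<Union>q \<in> {q \<in> K. Some q \<notin> U}. {p \<in> K. g p = q})"
      by auto
  qed (use that fibre almost in auto)
  then show ?thesis
    by (auto simp: continuous_map_def openin_cofinite_at_None f)
qed

lemma cofinite_at_None_eqD:
  assumes "cofinite_at_None K = cofinite_at_None L"
  shows "finite (L - K)"
proof -
  have "{p \<in> K. Some p \<notin> insert None (Some ` K)} = {}" by auto
  then have "openin (cofinite_at_None K) (insert None (Some ` K))"
    by (simp only: openin_cofinite_at_None finite.emptyI simp_thms)
  then have "finite {p \<in> L. Some p \<notin> insert None (Some ` K)}"
    unfolding assms by (simp add: openin_cofinite_at_None)
  then show ?thesis
    by (rule rev_finite_subset) auto
qed

section \<open>Shift-continuity\<close>

lemma shift_continuous_cofinite_at_None: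
  fixes W :: "(int \<times> int) set"
  assumes fst: "\<And>b. finite {p \<in> W. b \<le> fst p}" and snd: "\<And>b. finite {p \<in> W. b \<le> snd p}"
    and diag: "\<And>m b. finite {p. p \<notin> W \<and> snd p - fst p = m \<and> fst p \<le> b}"
  shows "shift_continuous ext_bicyclic0_mult (cofinite_at_None (- W))"
proof -
  let ?T = "cofinite_at_None (- W)"
  have const: "continuous_map ?T ?T (\<lambda>s. None)" by simp
  have left: "continuous_map ?T ?T (\<lambda>s. ext_bicyclic0_mult (Some (a, b)) s)" for a b
  proof (rule continuous_map_cofinite_at_None)
    let ?g = "ext_bicyclic_mult (a, b)"
    show fibre: "finite {p \<in> - W. ?g p = q}" for q
    proof (rule finite_subset)
      \<comment> \<open>For \<open>b < fst p\<close> the shift is injective, which gives the single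
        point; otherwise it is constant along diagonals.\<close>
      show "{p \<in> - W. ?g p = q} \<subseteq>
          {p. p \<notin> W \<and> snd p - fst p = snd q - b \<and> fst p \<le> b} \<union> {(fst q - a + b, snd q)}"
        by (auto simp: ext_bicyclic_mult_def split: if_splits)
    qed (use diag in auto)
    \<comment> \<open>Hence the image meets \<open>W\<close> in a finite set, and the fibres over it
      are finite.\<close>
    have "a \<le> fst (?g p)" for p
      by (auto simp: ext_bicyclic_mult_def split: prod.splits)
    then have "{p \<in> - W. ?g p \<notin> - W} \<subseteq> (\<Union>q \<in> {q \<in> W. a \<le> fst q}. {p \<in> - W. ?g p = q})"
      by auto
    then show "finite {p \<in> - W. ?g p \<notin> - W}"
      by (rule finite_subset) (use fst fibre in auto)
  qed auto
  have right: "continuous_map ?T ?T (\<lambda>s. ext_bicyclic0_mult s (Some (a, b)))" for a b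
  proof (rule continuous_map_cofinite_at_None)
    let ?g = "\<lambda>p. ext_bicyclic_mult p (a, b)"
    show fibre: "finite {p \<in> - W. ?g p = q}" for q
    proof (rule finite_subset)
      \<comment> \<open>The branch \<open>snd p \<le> a\<close> again gives the lower half of a
        diagonal: on this diagonal, that bound amounts to \<open>fst p \<le> fst q\<close>.\<close>
      show "{p \<in> - W. ?g p = q} \<subseteq>
          {p. p \<notin> W \<and> snd p - fst p = a - fst q \<and> fst p \<le> fst q} \<union> {(fst q, snd q - b + a)}"
        by (auto simp: ext_bicyclic_mult_def split: if_splits)
    qed (use diag in auto)
    have "b \<le> snd (?g p)" for p
      by (auto simp: ext_bicyclic_mult_def split: prod.splits)
    then have "{p \<in> - W. ?g p \<notin> - W} \<subseteq> (\<Union>q \<in> {q \<in> W. b \<le> snd q}. {p \<in> - W. ?g p = q})"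
      by auto
    then show "finite {p \<in> - W. ?g p \<notin> - W}"
      by (rule finite_subset) (use snd fibre in auto)
  qed auto
  have zero: "ext_bicyclic0_mult s None = None" for s by (cases s) auto
  show ?thesis
    unfolding shift_continuous_def
  proof
    fix t :: "(int \<times> int) option"
    show "continuous_map ?T ?T (\<lambda>s. ext_bicyclic0_mult t s) \<and>
        continuous_map ?T ?T (\<lambda>s. ext_bicyclic0_mult s t)"
      by (cases t) (use left right const zero in \<open>auto simp del: adjoin_zero.simps(1,3)\<close>)
  qed
qed

text \<open>For nonpositive coordinates the inequalities say that neither absolute value exceeds
  \<open>r\<close> times the other. For \<open>r > 1\<close> the cone surrounds the diagonal and
  widens with \<open>r\<close>.\<close>

definition diagonal_cone :: "real \<Rightarrow> (int \<times> int) set" where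
  "diagonal_cone r = {(c, d). c \<le> 0 \<and> d \<le> 0 \<and> r * of_int c \<le> of_int d \<and> r * of_int d \<le> of_int c}"

lemma finite_diagonal_cone_fst:
  assumes "0 < r"
  shows "finite {p \<in> diagonal_cone r. b \<le> fst p}"
proof (rule finite_subset)
  show "{p \<in> diagonal_cone r. b \<le> fst p} \<subseteq> {b..0} \<times> {\<lfloor>r * b\<rfloor>..0}"
  proof (clarsimp simp: diagonal_cone_def)
    fix c d :: int assume "b \<le> c" "r * c \<le> d"
    moreover have "r * b \<le> r * c" using \<open>b \<le> c\<close> assms by simp
    ultimately show "\<lfloor>r * b\<rfloor> \<le> d" by linarith
  qed
qed auto

text \<open>The cone is symmetric under exchange of coordinates.\<close>

lemma finite_diagonal_cone_snd:
  assumes "0 < r"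
  shows "finite {p \<in> diagonal_cone r. b \<le> snd p}"
proof -
  have "{p \<in> diagonal_cone r. b \<le> snd p} = prod.swap ` {p \<in> diagonal_cone r. b \<le> fst p}"
    by (force simp: diagonal_cone_def)
  then show ?thesis
    using finite_diagonal_cone_fst[OF assms] by simp
qed

text \<open>Far down a diagonal the ratio of the coordinates tends to 1, which is less than
  \<open>r\<close>.\<close>

lemma finite_diagonal_minus_cone:
  assumes "1 < r"
  shows "finite {p. p \<notin> diagonal_cone r \<and> snd p - fst p = m \<and> fst p \<le> b}"
proof (rule finite_subset)
  \<comment> \<open>Below \<open>- N\<close>, the summand \<open>\<bar>m\<bar>\<close> makes both
    coordinates nonpositive, and the quotient gives
    \<open>r * c + r * \<bar>m\<bar> \<le> c\<close>, from which both cone inequalities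
    follow.\<close>
  define N where "N = \<bar>m\<bar> + \<lceil>r * \<bar>m\<bar> / (r - 1)\<rceil>"
  show "{p. p \<notin> diagonal_cone r \<and> snd p - fst p = m \<and> fst p \<le> b} \<subseteq> (\<lambda>c. (c, c + m)) ` {- N..b}"
  proof
    fix p assume "p \<in> {p. p \<notin> diagonal_cone r \<and> snd p - fst p = m \<and> fst p \<le> b}"
    then obtain c where p: "p = (c, c + m)" and *: "(c, c + m) \<notin> diagonal_cone r" "c \<le> b"
      by (cases p) auto
    have "- N \<le> c"
    proof (rule ccontr)
      assume c: "\<not> - N \<le> c"
      have "0 \<le> r * \<bar>m\<bar> / (r - 1)" using assms by simp
      then have "\<bar>m\<bar> \<le> - c" and "r * \<bar>m\<bar> / (r - 1) \<le> - c"
        using c unfolding N_def by linarith+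
      then have 1: "r * \<bar>m\<bar> \<le> (r - 1) * - c"
        using assms by (simp add: pos_divide_le_eq mult.commute)
      have "1 * \<bar>real_of_int m\<bar> \<le> r * \<bar>real_of_int m\<bar>"
        using assms by (intro mult_right_mono) auto
      moreover have "r * m \<le> r * \<bar>m\<bar>"
        using assms by (intro mult_left_mono) auto
      ultimately have "r * c \<le> c + m" "r * (c + m) \<le> c"
        using 1 by (auto simp: algebra_simps)
      then show False
        using * \<open>\<bar>m\<bar> \<le> - c\<close> by (auto simp: diagonal_cone_def)
    qed
    then show "p \<in> (\<lambda>c. (c, c + m)) ` {- N..b}"
      using p * by auto
  qed
qed auto

text \<open>For each sufficiently negative \<open>c\<close> there is an integer \<open>d\<close>
  with \<open>s * c \<le> d < r * c\<close>, and \<open>(c, d)\<close> then lies in the wider cone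
  only.\<close>

lemma infinite_diagonal_cone_diff:
  assumes "1 < r" "r < s"
  shows "infinite (diagonal_cone s - diagonal_cone r)"
proof
  assume fin: "finite (diagonal_cone s - diagonal_cone r)"
  have "{..- \<lceil>2 / (s - r)\<rceil>} \<subseteq> fst ` (diagonal_cone s - diagonal_cone r)"
  proof
    fix c assume "c \<in> {..- \<lceil>2 / (s - r)\<rceil>}"
    \<comment> \<open>The bound on \<open>c\<close> makes the gap between \<open>s * c\<close> and
      \<open>r * c\<close> at least 2, so rounding \<open>s * c\<close> up stays below
      \<open>r * c\<close>.\<close>
    then have c: "2 / (s - r) \<le> - c" by simp linarith
    then have "2 \<le> (s - r) * - c"
      using assms by (simp add: pos_divide_le_eq mult.commute)
    then have rs: "s * c + 2 \<le> r * c" by (simp add: algebra_simps)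
    define d where "d = \<lceil>s * c\<rceil>"
    have d: "s * c \<le> d" "d < s * c + 1"
      unfolding d_def by linarith+
    have "0 < 2 / (s - r)" using assms by simp
    then have "c \<le> 0" using c by linarith
    then have "r * c \<le> 1 * real_of_int c"
      using assms by (intro mult_right_mono_neg) auto
    then have dc: "d \<le> c" "d \<le> 0" using d rs \<open>c \<le> 0\<close> by linarith+
    \<comment> \<open>Together with \<open>d \<le> c\<close> this is the second inequality of the
      wider cone.\<close>
    then have "s * d \<le> 1 * real_of_int d"
      using assms by (intro mult_right_mono_neg) auto
    then have "(c, d) \<in> diagonal_cone s - diagonal_cone r"
      using d rs dc \<open>c \<le> 0\<close> by (auto simp: diagonal_cone_def)
    then show "c \<in> fst ` (diagonal_cone s - diagonal_cone r)" by force
  qed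
  then have "finite {..- \<lceil>2 / (s - r)\<rceil>}"
    using fin finite_subset by blast
  then show False by (simp add: infinite_Iic)
qed

lemma inj_on_cofinite_at_None_diagonal_cone:
  "inj_on (\<lambda>r. cofinite_at_None (- diagonal_cone r)) {1<..}"
proof (rule linorder_inj_onI)
  fix r s :: real assume "r < s" "r \<in> {1<..}" "s \<in> {1<..}"
  show "cofinite_at_None (- diagonal_cone r) \<noteq> cofinite_at_None (- diagonal_cone s)"
  proof
    assume "cofinite_at_None (- diagonal_cone r) = cofinite_at_None (- diagonal_cone s)"
    then have "finite (- diagonal_cone r - - diagonal_cone s)"
      by (intro cofinite_at_None_eqD) simp
    moreover have "- diagonal_cone r - - diagonal_cone s = diagonal_cone s - diagonal_cone r"
      by auto
    ultimately show False
      using infinite_diagonal_cone_diff \<open>r < s\<close> \<open>r \<in> {1<..}\<close> by simp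
  qed
qed auto

theorem mainTheorem2:
  "{T :: (int \<times> int) option topology.
      topspace T = UNIV \<and> Hausdorff_space T \<and> locally_compact_space T \<and>
      shift_continuous ext_bicyclic0_mult T} \<approx> (UNIV :: real set)"
    (is "?L \<approx> _")
proof (rule lepoll_antisym)
  have "?L \<subseteq> {T. topspace T = UNIV \<and> Hausdorff_space T \<and> locally_compact_space T}" by auto
  then show "?L \<lesssim> (UNIV :: real set)"
    using locally_compact_Hausdorff_topologies_lepoll_reals lepoll_trans subset_imp_lepoll by blast
next
  have "cofinite_at_None (- diagonal_cone r) \<in> ?L" if "1 < r" for r
    using that finite_diagonal_cone_fst finite_diagonal_cone_snd finite_diagonal_minus_cone
    by (simp add: Hausdorff_cofinite_at_None locally_compact_cofinite_at_None
        shift_continuous_cofinite_at_None)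
  then have "{1::real<..} \<lesssim> ?L"
    unfolding lepoll_def using inj_on_cofinite_at_None_diagonal_cone
    by (intro exI[of _ "\<lambda>r. cofinite_at_None (- diagonal_cone r)"]) auto
  \<comment> \<open>The ray contains the interval between 1 and 2, which already has the cardinality
    of the continuum.\<close>
  moreover have "(UNIV :: real set) \<approx> {1::real<..}"
    by (rule eqpoll_sym, rule eqpoll_real_subset[of 1 2]) auto
  ultimately show "(UNIV :: real set) \<lesssim> ?L"
    using lepoll_trans1 by blast
qed

end
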